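(* Let $A$ be an $n\times n$ real matrix that is similar to an $n\times n$ real diagonal matrix, and consider the linear time-invariant system $\dot r(t)=Ar(t)$, $r(t)\in\mathbb{R}^n$. Let $i\ge 1$ be an integer, and for a solution $r(t)$ denote by $\kappa_i(t)$ the $i$th curvature of its trajectory. Then: (1) If there exists a measurable set $E\subseteq\mathbb{R}^n$ of Lebesgue measure greater than $0$ such that for every solution with $r(0)\in E$ either $\lim_{t\to+\infty}\kappa_i(t)\neq 0$ or $\lim_{t\to+\infty}\kappa_i(t)$ does not exist, then the zero solution of the system is stable. (2) If $A$ is invertible and there exists a set $E$ as in (1), then the zero solution of the system is asymptotically stable.
   Context: Similarity is over $\mathbb{R}$: $A=P^{-1}BP$ with $P$ a real invertible matrix. The solution of $\dot r=Ar$ with initial value $r(0)$ is $r(t)=e^{tA}r(0)$, $t\in[0,+\infty)$. Stability: the zero solution $r\equiv 0$ is stable if for every $\varepsilon>0$ there is $\delta>0$ such that $\|r(0)\|<\delta$ implies $\|r(t)\|<\varepsilon$ for all $t\ge 0$, for every solution $r$. It is asymptotically stable if it is stable and there is $\tilde\delta>0$ such that $\|r(0)\|<\tilde\delta$ implies $\lim_{t\to+\infty}r(t)=0$. Curvatures: for a smooth curve $r$ in $\mathbb{R}^n$, let $V_k(t)$ be the $k$-dimensional volume of the parallelotope spanned by $\dot r(t),\ddot r(t),\dots,r^{(k)}(t)$ ($V_0(t)=1$). Equivalently, for $k\ge1$, $V_k^2(t)$ is the sum, over all $1\le i_1<\dots<i_k\le n$, of the squares of the determinants of the $k\times k$ matrices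 with $(p,q)$ entry $r_{i_p}^{(q)}(t)$ (so $V_k=0$ if $k>n$). The $i$th curvature is $$\kappa_i(t)=\frac{V_{i-1}(t)V_{i+1}(t)}{V_1(t)V_i^2(t)}$$ when $V_i(t)\neq 0$. If $V_i\equiv 0$ along the trajectory, the convention is $\kappa_i\equiv 0$. (For a solution of a linear time-invariant system, $V_i$ is either identically zero or nowhere zero.) A limit equal to $+\infty$ counts as satisfying the condition "$\neq 0$ or does not exist"; that is, the condition says that $\kappa_i(t)$ does not converge to $0$. *)

theory Defs
  imports "Jordan_Normal_Form.Determinant" "HOL-Analysis.Analysis"
begin

no_notation vec_index (infixl \<open>$\<close> 100)

definition similar_matrix :: "real^'n^'n \<Rightarrow> real^'n^'n \<Rightarrow> bool" where
  "similar_matrix A B \<longleftrightarrow> (\<exists>P. invertible P \<and> A = matrix_inv P ** B ** P)"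

definition is_diagonal :: "real^'n^'n \<Rightarrow> bool" where
  "is_diagonal D \<longleftrightarrow> (\<forall>i j. i \<noteq> j \<longrightarrow> D $ i $ j = 0)"

text \<open>Trajectories live on \<open>t \<ge> 0\<close>, so every derivative is taken within \<open>{0..}\<close> (one-sided at
  \<open>0\<close>); the values of \<open>r\<close> at negative times are irrelevant.\<close>

definition lti_solution :: "real^'n^'n \<Rightarrow> (real \<Rightarrow> real^'n) \<Rightarrow> bool" where
  "lti_solution A r \<longleftrightarrow> (\<forall>t\<ge>0. (r has_vector_derivative A *v r t) (at t within {0..}))"

definition curve_deriv :: "nat \<Rightarrow> (real \<Rightarrow> real^'n) \<Rightarrow> real \<Rightarrow> real^'n" where
  "curve_deriv k = (\<lambda>f t. vector_derivative f (at t within {0..})) ^^ k"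

definition lti_stable :: "real^'n^'n \<Rightarrow> bool" where
  "lti_stable A \<longleftrightarrow>
     (\<forall>\<epsilon>>0. \<exists>\<delta>>0. \<forall>r. lti_solution A r \<longrightarrow> norm (r 0) < \<delta> \<longrightarrow> (\<forall>t\<ge>0. norm (r t) < \<epsilon>))"

definition lti_asymptotically_stable :: "real^'n^'n \<Rightarrow> bool" where
  "lti_asymptotically_stable A \<longleftrightarrow>
     lti_stable A \<and>
     (\<exists>\<delta>>0. \<forall>r. lti_solution A r \<longrightarrow> norm (r 0) < \<delta> \<longrightarrow> (r \<longlongrightarrow> 0) at_top)"

text \<open>The \<open>k\<close>-dimensional volume of the parallelotope spanned by the first \<open>k\<close> derivatives:
  its square is the sum of the squared \<open>k \<times> k\<close> minors. A choice of coordinates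
  \<open>i\<^sub>1 < \<dots> < i\<^sub>k\<close> is a \<open>k\<close>-element set \<open>I\<close> of indices. The index type carries no order, so
  \<open>from_nat_into I\<close>, a bijection from \<open>{..<k}\<close> to \<open>I\<close>, lists the elements of \<open>I\<close> in some order; this
  affects only the sign of the determinant. Positions are counted from \<open>0\<close>, so column \<open>q\<close> holds the
  derivative of order \<open>q + 1\<close>. For \<open>k = 0\<close> the sum is the single empty determinant \<open>1\<close>; for
  \<open>k > CARD('n)\<close> it is empty.\<close>

definition deriv_volume :: "nat \<Rightarrow> (real \<Rightarrow> real^'n) \<Rightarrow> real \<Rightarrow> real" where
  "deriv_volume k r t =
     sqrt (\<Sum>I | I \<subseteq> (UNIV :: 'n set) \<and> card I = k.
       (Determinant.det (Matrix.mat k k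
          (\<lambda>(p, q). curve_deriv (Suc q) r t $ from_nat_into I p)))\<^sup>2)"

text \<open>Along a solution the volume of each order is identically zero or nowhere zero, so the
  convention \<open>\<kappa>\<^sub>i \<equiv> 0\<close> when \<open>V\<^sub>i \<equiv> 0\<close> can be imposed pointwise.\<close>

definition curvature :: "nat \<Rightarrow> (real \<Rightarrow> real^'n) \<Rightarrow> real \<Rightarrow> real" where
  "curvature i r t =
     (if deriv_volume i r t = 0 then 0
      else deriv_volume (i - 1) r t * deriv_volume (i + 1) r t /
           (deriv_volume 1 r t * (deriv_volume i r t)\<^sup>2))"

end

theory Submission
  imports Defs
begin

text \<open>
  Diagonalizing \<open>A\<close> splits a solution into modes: \<open>r t = b + (\<Sum>l<m. exp (\<mu> l * t) *\<^sub>R w l)\<close>, where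
  \<open>\<mu> 0 > \<mu> 1 > \<dots>\<close> are the distinct nonzero eigenvalues, \<open>w l\<close> is the component of the initial
  value in the eigenspace of \<open>\<mu> l\<close>, and \<open>b\<close> is its component in the kernel of \<open>A\<close>. If the initial
  value has no vanishing coordinate in the eigenbasis, all \<open>w l\<close> are nonzero, hence linearly
  independent. This excludes only finitely many hyperplanes, so a set of positive measure contains
  such initial values.

  The volume spanned by the first \<open>k \<le> m\<close> derivatives then grows exactly like the product of the
  \<open>k\<close> fastest modes, \<open>exp ((\<mu> 0 + \<dots> + \<mu> (k - 1)) * t)\<close>, up to a factor with a positive limit
  (\<open>deriv_volume_asymptotics\<close>); for \<open>k > m\<close> it vanishes (\<open>deriv_volume_eq_0\<close>). In the quotient
  defining the \<open>i\<close>th curvature the sums of exponents telescope, and what remains is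
  \<open>exp ((\<mu> i - \<mu> (i - 1) - \<mu> 0) * t)\<close> times a convergent factor. Since \<open>\<mu> i < \<mu> (i - 1)\<close>, a
  positive largest eigenvalue \<open>\<mu> 0\<close> forces the curvature to tend to \<open>0\<close>
  (\<open>curvature_exp_sum_tendsto_0\<close>).

  So if the curvature does not tend to \<open>0\<close> on a set of positive measure, no eigenvalue is positive.
  Each eigencoordinate of a solution is \<open>exp (d j * t)\<close> times its initial value, so all solutions
  are bounded by a fixed multiple of their initial value, which is stability. If \<open>A\<close> is invertible
  the eigenvalues are even negative, and all solutions decay.
\<close>

section \<open>Square matrices given by their entries\<close>

lemma mat_mult_mat:
  "Matrix.mat k k f * Matrix.mat k k g
    = Matrix.mat k k (\<lambda>(p, j). \<Sum>q<k. f (p, q) * (g (q, j) :: 'a :: comm_semiring_0))"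
  by (rule eq_matI) (auto simp: scalar_prod_def lessThan_atLeast0)

lemma mat_mult_diagonal_mat:
  "Matrix.mat k k f * Matrix.mat k k (\<lambda>(p, q). if p = q then h p else 0)
    = Matrix.mat k k (\<lambda>(p, j). f (p, j) * (h j :: real))"
proof -
  have "(\<Sum>q<k. f (p, q) * (if q = j then h q else 0)) = f (p, j) * h j" if "j < k" for p j
  proof -
    have "(\<Sum>q<k. f (p, q) * (if q = j then h q else 0))
        = (\<Sum>q<k. if q = j then f (p, j) * h j else 0)"
      by (intro sum.cong) auto
    then show ?thesis using that by simp
  qed
  then show ?thesis unfolding mat_mult_mat by (intro eq_matI) auto
qed

lemma det_diagonal_function:
  "Determinant.det (Matrix.mat k k (\<lambda>(p, q). if p = q then f p else 0)) = (\<Prod>p<k. f p :: real)"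
  by (subst det_upper_triangular[where n = k])
     (auto simp: upper_triangular_def prod_list_diag_prod lessThan_atLeast0)

lemma tendsto_det_mat:
  fixes f :: "'a \<Rightarrow> nat \<times> nat \<Rightarrow> real"
  assumes "\<And>p q. p < k \<Longrightarrow> q < k \<Longrightarrow> ((\<lambda>t. f t (p, q)) \<longlongrightarrow> g (p, q)) F"
  shows "((\<lambda>t. Determinant.det (Matrix.mat k k (f t))) \<longlongrightarrow> Determinant.det (Matrix.mat k k g)) F"
proof -
  have entry: "((\<lambda>t. Matrix.mat k k (f t) $$ (p, \<pi> p)) \<longlongrightarrow> Matrix.mat k k g $$ (p, \<pi> p)) F"
    if "\<pi> permutes {0..<k}" "p \<in> {0..<k}" for p \<pi>
  proof -
    have "\<pi> p < k" using permutes_in_image[OF that(1)] that(2) by auto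
    then show ?thesis using that assms by auto
  qed
  show ?thesis
    by (subst (1 2) det_def'[where n = k])
       (use entry in \<open>auto simp del: index_mat(1) intro!: tendsto_sum tendsto_mult tendsto_prod\<close>)
qed

lemma det_mat_eq_0_if_kernel:
  fixes f :: "nat \<times> nat \<Rightarrow> real"
  assumes "\<And>p. p < k \<Longrightarrow> (\<Sum>q<k. f (p, q) * c q) = 0" and "j < k" and "c j \<noteq> 0"
  shows "Determinant.det (Matrix.mat k k f) = 0"
proof -
  have "Matrix.vec k c \<noteq> 0\<^sub>v k"
    using assms(2,3) by (metis index_vec index_zero_vec(1))
  moreover have "Matrix.mat k k f *\<^sub>v Matrix.vec k c = 0\<^sub>v k"
    using assms(1) by (auto simp: mult_mat_vec_def scalar_prod_def lessThan_atLeast0)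
  ultimately show ?thesis
    by (subst det_0_iff_vec_prod_zero[where n = k]) (auto intro!: exI[of _ "Matrix.vec k c"])
qed

lemma kernel_if_det_mat_eq_0:
  fixes f :: "nat \<times> nat \<Rightarrow> real"
  assumes "Determinant.det (Matrix.mat k k f) = 0"
  obtains c j where "\<And>p. p < k \<Longrightarrow> (\<Sum>q<k. f (p, q) * c q) = 0" "j < k" "c j \<noteq> 0"
proof -
  obtain v where v: "v \<in> carrier_vec k" "v \<noteq> 0\<^sub>v k" "Matrix.mat k k f *\<^sub>v v = 0\<^sub>v k"
    using assms by (subst (asm) det_0_iff_vec_prod_zero[where n = k]) auto
  have "\<exists>j<k. vec_index v j \<noteq> 0"
  proof (rule ccontr)
    assume "\<not> ?thesis"
    then have "v = 0\<^sub>v k" using v(1) by (intro eq_vecI) auto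
    with v(2) show False by simp
  qed
  then obtain j where "j < k" "vec_index v j \<noteq> 0" by blast
  moreover have "(\<Sum>q<k. f (p, q) * vec_index v q) = 0" if "p < k" for p
  proof -
    have "(\<Sum>q<k. f (p, q) * vec_index v q) = vec_index (Matrix.mat k k f *\<^sub>v v) p"
      using that v(1) by (simp add: scalar_prod_def lessThan_atLeast0)
    with v(3) that show ?thesis by simp
  qed
  ultimately show thesis using that by blast
qed

section \<open>A nonzero minor of linearly independent vectors\<close>

text \<open>Basis extension: the \<open>k\<close> vectors extend to a basis by unit vectors
  \<open>axis j 1\<close> with \<open>j \<in> J\<close>, so the complement \<open>I\<close> of \<open>J\<close> has \<open>k\<close> elements. A kernel vector of the
  minor at \<open>I\<close> would be a combination of the \<open>w l\<close> whose coordinates in \<open>I\<close> vanish, that is, one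
  lying in the span of the added unit vectors, against independence of the basis.\<close>

lemma exists_nonzero_minor:
  fixes w :: "nat \<Rightarrow> real^'n"
  assumes indep: "\<And>c l. (\<Sum>l<k. c l *\<^sub>R w l) = 0 \<Longrightarrow> l < k \<Longrightarrow> c l = 0"
  obtains I :: "'n set" where "card I = k"
    "Determinant.det (Matrix.mat k k (\<lambda>(p, q). w q $ from_nat_into I p)) \<noteq> 0"
proof -
  let ?W = "w ` {..<k}"
  have inj: "inj_on w {..<k}"
  proof (rule inj_onI, rule ccontr)
    fix a b assume ab: "a \<in> {..<k}" "b \<in> {..<k}" "w a = w b" "a \<noteq> b"
    have "(\<Sum>l<k. (of_bool (l = a) - of_bool (l = b)) *\<^sub>R w l) = w a - w b"
      using ab by (simp add: scaleR_left_diff_distrib sum_subtractf of_bool_def if_distrib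
          [of "\<lambda>x. x *\<^sub>R _"] cong: if_cong)
    with indep[of "\<lambda>l. of_bool (l = a) - of_bool (l = b)" a] ab show False by simp
  qed
  have "independent ?W"
  proof (rule independent_if_scalars_zero)
    fix f x assume f: "(\<Sum>x\<in>?W. f x *\<^sub>R x) = 0" and x: "x \<in> ?W"
    have "(\<Sum>l<k. f (w l) *\<^sub>R w l) = 0"
      using f by (simp add: sum.reindex[OF inj] o_def)
    from indep[OF this] x show "f x = 0" by auto
  qed simp
  then obtain B where B: "?W \<subseteq> B" "B \<subseteq> ?W \<union> range (\<lambda>j. axis j 1)" "independent B"
      "?W \<union> range (\<lambda>j. axis j 1) \<subseteq> span B"
    using maximal_independent_subset_extend[of ?W "?W \<union> range (\<lambda>j. axis j (1::real))"] by blast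
  have finB: "finite B" using B(3) by (rule independent_imp_finite)
  have spanB: "span B = UNIV"
  proof -
    have "Basis \<subseteq> span B" using B(4) by (auto simp: Basis_vec_def)
    then have "span Basis \<subseteq> span B" by (metis span_mono span_span)
    then show ?thesis by auto
  qed
  have cardB: "card B = CARD('n)"
    using basis_card_eq_dim[of B UNIV] B(3) spanB by (simp add: dim_UNIV)
  define J where "J = {j. axis j 1 \<in> B - ?W}"
  have BJ: "B - ?W = (\<lambda>j. axis j 1) ` J" using B(2) by (auto simp: J_def)
  have injax: "inj_on (\<lambda>j. axis j (1::real) :: real^'n) J"
    by (auto simp: inj_on_def axis_eq_axis)
  have "card ?W = k" by (simp add: card_image[OF inj])
  then have "card B = k + card J"
    using card_Diff_subset[of ?W B] B(1) finB card_mono[OF finB B(1)]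
    by (simp add: BJ card_image[OF injax])
  then have cardI: "card (- J) = k" using cardB by (simp add: Compl_eq_Diff_UNIV card_Diff_subset)
  have bij: "bij_betw (from_nat_into (- J)) {..<k} (- J)"
    using bij_betw_from_nat_into_finite[of "- J"] cardI by simp
  have "Determinant.det (Matrix.mat k k (\<lambda>(p, q). w q $ from_nat_into (- J) p)) \<noteq> 0"
  proof
    assume "Determinant.det (Matrix.mat k k (\<lambda>(p, q). w q $ from_nat_into (- J) p)) = 0"
    then obtain c j where c: "\<And>p. p < k \<Longrightarrow> (\<Sum>q<k. w q $ from_nat_into (- J) p * c q) = 0"
        "j < k" "c j \<noteq> 0"
      by (rule kernel_if_det_mat_eq_0) auto
    define x where "x = (\<Sum>q<k. c q *\<^sub>R w q)"
    have x0: "x $ i = 0" if "i \<notin> J" for i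
    proof -
      have "i \<in> from_nat_into (- J) ` {..<k}" using bij that by (simp add: bij_betw_def)
      then obtain p where "p < k" "i = from_nat_into (- J) p" by blast
      then show ?thesis using c(1)[of p] by (simp add: x_def mult.commute)
    qed
    have xJ: "x = (\<Sum>i\<in>J. x $ i *\<^sub>R axis i 1)"
    proof (subst vec_eq_iff, rule allI)
      fix i
      show "x $ i = (\<Sum>i\<in>J. x $ i *\<^sub>R axis i 1) $ i"
        using x0[of i] by (simp add: axis_def if_distrib cong: if_cong)
    qed
    \<comment> \<open>The coefficients of \<open>x - x\<close>, with one \<open>x\<close> expanded over the \<open>w q\<close> and the other over the
      added unit vectors.\<close>
    define g where "g b = (if b \<in> ?W then c (the_inv_into {..<k} w b) else - (b \<bullet> x))" for b
    have "(\<Sum>b\<in>B. g b *\<^sub>R b) = (\<Sum>b\<in>?W. g b *\<^sub>R b) + (\<Sum>b\<in>B - ?W. g b *\<^sub>R b)"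
      using sum.subset_diff[OF B(1) finB] by (simp add: add.commute)
    also have "(\<Sum>b\<in>?W. g b *\<^sub>R b) = x"
      unfolding x_def by (subst sum.reindex[OF inj])
        (auto intro!: sum.cong simp: g_def the_inv_into_f_f[OF inj])
    also have "(\<Sum>b\<in>B - ?W. g b *\<^sub>R b) = (\<Sum>b\<in>B - ?W. - ((b \<bullet> x) *\<^sub>R b))"
      by (intro sum.cong) (auto simp: g_def)
    also have "\<dots> = - x"
      by (subst (2) xJ)
        (simp add: BJ sum.reindex[OF injax] sum_negf inner_axis' o_def)
    finally have "(\<Sum>b\<in>B. g b *\<^sub>R b) = 0" by simp
    moreover have "w j \<in> B" using B(1) c(2) by auto
    ultimately have "g (w j) = 0"
      using independentD[OF B(3) finB, of g "w j"] by blast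
    then show False using c(2,3) by (auto simp: g_def the_inv_into_f_f[OF inj])
  qed
  then show thesis using that cardI by blast
qed

section \<open>Interpolation without constant term\<close>

lemma poly_eq_sum_lessThan:
  assumes "degree p < k"
  shows "poly p (x :: real) = (\<Sum>q<k. coeff p q * x ^ q)"
  unfolding poly_altdef using assms
  by (intro sum.mono_neutral_left) (auto simp: coeff_eq_0)

lemma degree_prod_linear:
  assumes "finite S"
  shows "degree (\<Prod>l\<in>S. [:- (\<mu> l :: real), 1:]) = card S"
  by (subst degree_prod_eq_sum_degree) auto

text \<open>Column \<open>j\<close> of \<open>C\<close> holds the coefficients of the polynomial without constant term that takes the
  value \<open>1\<close> at \<open>\<mu> j\<close> and \<open>0\<close> at the other nodes: Lagrange interpolation with the additional node
  \<open>0\<close>. Applied to the derivatives of order \<open>1, \<dots>, k\<close> of a sum of exponentials, it isolates the mode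
  \<open>\<mu> j\<close> among the first \<open>k\<close> ones. Being a right inverse of the matrix of powers of the nodes, \<open>C\<close>
  has nonzero determinant.\<close>

lemma exists_interpolation_coeffs:
  fixes \<mu> :: "nat \<Rightarrow> real"
  assumes inj: "inj_on \<mu> {..<k}" and nz: "\<And>l. l < k \<Longrightarrow> \<mu> l \<noteq> 0"
  obtains C :: "nat \<Rightarrow> nat \<Rightarrow> real" where
    "\<And>l j. l < k \<Longrightarrow> j < k \<Longrightarrow> (\<Sum>q<k. \<mu> l ^ Suc q * C q j) = (if l = j then 1 else 0)"
    "Determinant.det (Matrix.mat k k (\<lambda>(q, j). C q j)) \<noteq> 0"
proof -
  define N where "N j = (\<Prod>l\<in>{..<k} - {j}. [:- \<mu> l, 1:])" for j
  define C where "C q j = coeff (N j) q / (\<mu> j * poly (N j) (\<mu> j))" for q j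
  have deg: "degree (N j) < k" if "j < k" for j
    using that by (simp add: N_def degree_prod_linear)
  have N_eq_0: "poly (N j) (\<mu> l) = 0 \<longleftrightarrow> l \<noteq> j" if "l < k" "j < k" for l j
    using that inj by (auto simp: N_def poly_prod inj_on_def)
  have delta: "(\<Sum>q<k. \<mu> l ^ Suc q * C q j) = (if l = j then 1 else 0)" if "l < k" "j < k" for l j
  proof -
    have "(\<Sum>q<k. \<mu> l ^ Suc q * C q j) = \<mu> l * poly (N j) (\<mu> l) / (\<mu> j * poly (N j) (\<mu> j))"
      by (simp add: poly_eq_sum_lessThan[OF deg[OF that(2)]] C_def sum_distrib_left
          sum_divide_distrib mult_ac)
    then show ?thesis using N_eq_0[OF that] N_eq_0[OF that(2,2)] nz that by auto
  qed
  have "Matrix.mat k k (\<lambda>(l, q). \<mu> l ^ Suc q) * Matrix.mat k k (\<lambda>(q, j). C q j) = 1\<^sub>m k"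
    unfolding mat_mult_mat by (rule eq_matI) (use delta in auto)
  then have "Determinant.det (Matrix.mat k k (\<lambda>(l, q). \<mu> l ^ Suc q))
      * Determinant.det (Matrix.mat k k (\<lambda>(q, j). C q j)) = 1"
    by (metis det_mult det_one mat_carrier)
  then have "Determinant.det (Matrix.mat k k (\<lambda>(q, j). C q j)) \<noteq> 0" by auto
  then show thesis using that delta by blast
qed

section \<open>Volumes spanned by the derivatives of a sum of exponentials\<close>

lemma exp_neg_tendsto_0:
  assumes "a < (0 :: real)"
  shows "((\<lambda>t. exp (a * t)) \<longlongrightarrow> 0) at_top"
  by (rule filterlim_compose[OF exp_at_bot])
     (use assms in \<open>auto intro!: filterlim_tendsto_neg_mult_at_bot[OF tendsto_const _ filterlim_ident]\<close>)

lemma curve_deriv_exp_sum: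
  fixes r :: "real \<Rightarrow> real^'n" and m :: nat
  assumes r: "\<And>t. 0 \<le> t \<Longrightarrow> r t = b + (\<Sum>l<m. exp (\<mu> l * t) *\<^sub>R w l)" and "0 \<le> t"
  shows "curve_deriv (Suc q) r t = (\<Sum>l<m. (\<mu> l ^ Suc q * exp (\<mu> l * t)) *\<^sub>R w l)"
  using \<open>0 \<le> t\<close>
proof (induction q arbitrary: t)
  have step: "vector_derivative f (at t within {0..}) = (\<Sum>l<m. (\<mu> l * c l * exp (\<mu> l * t)) *\<^sub>R w l)"
    if f: "\<And>t. 0 \<le> t \<Longrightarrow> f t = b + (\<Sum>l<m. (c l * exp (\<mu> l * t)) *\<^sub>R w l)" and "0 \<le> t"
    for f :: "real \<Rightarrow> real^'n" and b c t
  proof (rule vector_derivative_within)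
    show "at t within {0..} \<noteq> bot"
    proof -
      have "at_right t \<le> at t within {0..}" using \<open>0 \<le> t\<close> by (intro at_le) auto
      then show ?thesis using trivial_limit_at_right_real[of t] by (auto simp: bot_unique)
    qed
    have "((\<lambda>t. b + (\<Sum>l<m. (c l * exp (\<mu> l * t)) *\<^sub>R w l)) has_vector_derivative
        (\<Sum>l<m. (\<mu> l * c l * exp (\<mu> l * t)) *\<^sub>R w l)) (at t within {0..})"
      by (auto intro!: derivative_eq_intros simp: mult_ac)
    then show "(f has_vector_derivative (\<Sum>l<m. (\<mu> l * c l * exp (\<mu> l * t)) *\<^sub>R w l)) (at t within {0..})"
      by (rule has_vector_derivative_transform[rotated 2]) (use f \<open>0 \<le> t\<close> in auto)
  qed
  case 0
  show ?case using step[of r b "\<lambda>_. 1" t] r 0 by (simp add: curve_deriv_def)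
  case (Suc q)
  show ?case
    using step[of "curve_deriv (Suc q) r" 0 "\<lambda>l. \<mu> l ^ Suc q" t] Suc
    by (simp add: curve_deriv_def mult_ac)
qed

text \<open>Multiplying the matrix of derivatives by the interpolation matrix \<open>C\<close> turns its \<open>j\<close>th column into
  \<open>exp (\<mu> j * t) *\<^sub>R w j\<close> plus modes slower than all of the first \<open>k\<close>. Scaling that column by
  \<open>exp (- \<mu> j * t)\<close> makes it converge to \<open>w j\<close>. Hence each minor, multiplied by the determinants of
  the two factors, converges to the corresponding minor of \<open>w 0, \<dots>, w (k - 1)\<close>, and one of those
  is nonzero by independence.\<close>

lemma deriv_volume_asymptotics:
  fixes r :: "real \<Rightarrow> real^'n" and m :: nat
  assumes r: "\<And>t. 0 \<le> t \<Longrightarrow> r t = b + (\<Sum>l<m. exp (\<mu> l * t) *\<^sub>R w l)"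
    and decreasing: "\<And>j l. j < l \<Longrightarrow> l < m \<Longrightarrow> \<mu> l < \<mu> j"
    and nz: "\<And>l. l < m \<Longrightarrow> \<mu> l \<noteq> 0"
    and indep: "\<And>c l. (\<Sum>l<m. c l *\<^sub>R w l) = 0 \<Longrightarrow> l < m \<Longrightarrow> c l = 0"
    and "k \<le> m"
  obtains L where "L > 0"
    "((\<lambda>t. deriv_volume k r t * exp (- (\<Sum>l<k. \<mu> l) * t)) \<longlongrightarrow> L) at_top"
proof -
  have "inj_on \<mu> {..<k}"
    using decreasing \<open>k \<le> m\<close> unfolding inj_on_def
    by (metis lessThan_iff less_irrefl linorder_neqE_nat order_less_le_trans)
  then obtain C where C: "\<And>l j. l < k \<Longrightarrow> j < k \<Longrightarrow> (\<Sum>q<k. \<mu> l ^ Suc q * C q j) = (if l = j then 1 else 0)"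
      and detC: "Determinant.det (Matrix.mat k k (\<lambda>(q, j). C q j)) \<noteq> 0"
    using nz \<open>k \<le> m\<close> by (elim exists_interpolation_coeffs) auto
  let ?detC = "Determinant.det (Matrix.mat k k (\<lambda>(q, j). C q j))"
  define E where "E t = exp (- (\<Sum>l<k. \<mu> l) * t)" for t
  define F where "F I t = Determinant.det (Matrix.mat k k
    (\<lambda>(p, q). curve_deriv (Suc q) r t $ from_nat_into I p))" for I :: "'n set" and t
  define M where "M I = Determinant.det (Matrix.mat k k (\<lambda>(p, q). w q $ from_nat_into I p))"
    for I :: "'n set"
  have lim: "((\<lambda>t. F I t * E t) \<longlongrightarrow> M I / ?detC) at_top" for I
  proof -
    define g where "g t = (\<lambda>(p, j). \<Sum>l<m. exp ((\<mu> l - \<mu> j) * t) *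
        ((\<Sum>q<k. \<mu> l ^ Suc q * C q j) * w l $ from_nat_into I p))" for t
    have prod: "F I t * ?detC * E t = Determinant.det (Matrix.mat k k (g t))" if "0 \<le> t" for t
    proof -
      let ?F = "Matrix.mat k k (\<lambda>(p, q). curve_deriv (Suc q) r t $ from_nat_into I p)"
      let ?C = "Matrix.mat k k (\<lambda>(q, j). C q j)"
      let ?D = "Matrix.mat k k (\<lambda>(p, q). if p = q then exp (- \<mu> p * t) else 0)"
      have entry: "(\<Sum>q<k. curve_deriv (Suc q) r t $ from_nat_into I p * C q j) * exp (- \<mu> j * t)
          = g t (p, j)" for p j
      proof -
        let ?a = "\<lambda>l q. \<mu> l ^ Suc q * exp (\<mu> l * t) * w l $ from_nat_into I p * C q j * exp (- \<mu> j * t)"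
        have "(\<Sum>q<k. curve_deriv (Suc q) r t $ from_nat_into I p * C q j) * exp (- \<mu> j * t)
            = (\<Sum>q<k. \<Sum>l<m. ?a l q)"
          using curve_deriv_exp_sum[OF r that] by (simp add: sum_distrib_right)
        also have "\<dots> = (\<Sum>l<m. \<Sum>q<k. ?a l q)" by (rule sum.swap)
        also have "\<dots> = g t (p, j)"
        proof -
          have "exp ((\<mu> l - \<mu> j) * t) = exp (\<mu> l * t) * exp (- \<mu> j * t)" for l
            by (subst exp_add[symmetric]) (simp add: algebra_simps)
          then show ?thesis
            unfolding g_def prod.case sum_distrib_left sum_distrib_right
            by (intro sum.cong refl) (simp only: mult_ac)
        qed
        finally show ?thesis .
      qed
      have product: "?F * ?C * ?D = Matrix.mat k k (g t)"
        by (subst mat_mult_mat, subst mat_mult_diagonal_mat, rule eq_matI) (use entry in \<open>simp_all del: power_Suc\<close>)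
      have "Determinant.det (Matrix.mat k k (g t)) = Determinant.det ?F * ?detC * Determinant.det ?D"
        by (simp only: product[symmetric] det_mult[OF mat_carrier mat_carrier]
            det_mult[OF mult_carrier_mat[OF mat_carrier mat_carrier] mat_carrier])
      also have "Determinant.det ?D = E t"
        by (subst det_diagonal_function) (simp add: E_def exp_sum[symmetric] sum_distrib_right sum_negf)
      finally show ?thesis by (simp add: F_def)
    qed
    have "((\<lambda>t. g t (p, j)) \<longlongrightarrow> w j $ from_nat_into I p) at_top" if "p < k" "j < k" for p j
    proof -
      have "((\<lambda>t. exp ((\<mu> l - \<mu> j) * t) * ((\<Sum>q<k. \<mu> l ^ Suc q * C q j) * w l $ from_nat_into I p))
          \<longlongrightarrow> (if l = j then w j $ from_nat_into I p else 0)) at_top" if "l < m" for l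
      proof (cases "l < k")
        case True
        then show ?thesis using C[OF True \<open>j < k\<close>] by simp
      next
        case False
        then have "\<mu> l - \<mu> j < 0" using decreasing[of j l] \<open>j < k\<close> that by simp
        from tendsto_mult_right[OF exp_neg_tendsto_0[OF this]] show ?thesis
          using False \<open>j < k\<close> by auto
      qed
      then have "((\<lambda>t. g t (p, j)) \<longlongrightarrow> (\<Sum>l<m. if l = j then w j $ from_nat_into I p else 0)) at_top"
        unfolding g_def prod.case by (intro tendsto_sum) (simp only: lessThan_iff)
      then show ?thesis using \<open>j < k\<close> \<open>k \<le> m\<close> by simp
    qed
    then have "((\<lambda>t. Determinant.det (Matrix.mat k k (g t))) \<longlongrightarrow> M I) at_top"
      unfolding M_def by (intro tendsto_det_mat) auto
    then have "((\<lambda>t. F I t * ?detC * E t) \<longlongrightarrow> M I) at_top"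
      by (rule Lim_transform_eventually)
        (use prod in \<open>auto simp: eventually_at_top_linorder intro!: exI[of _ 0]\<close>)
    from tendsto_divide[OF this tendsto_const[of ?detC] detC] detC show ?thesis
      by simp
  qed
  let ?L = "sqrt (\<Sum>I | I \<subseteq> (UNIV :: 'n set) \<and> card I = k. (M I / ?detC)\<^sup>2)"
  have "deriv_volume k r t * E t
      = sqrt (\<Sum>I | I \<subseteq> (UNIV :: 'n set) \<and> card I = k. (F I t * E t)\<^sup>2)" for t
    unfolding deriv_volume_def F_def[symmetric]
    by (simp add: power_mult_distrib sum_distrib_right[symmetric] real_sqrt_mult E_def)
  moreover have "((\<lambda>t. sqrt (\<Sum>I | I \<subseteq> (UNIV :: 'n set) \<and> card I = k. (F I t * E t)\<^sup>2)) \<longlongrightarrow> ?L) at_top"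
    by (intro tendsto_intros lim)
  ultimately have "((\<lambda>t. deriv_volume k r t * E t) \<longlongrightarrow> ?L) at_top" by simp
  moreover have "?L > 0"
  proof -
    have "c l = 0" if "(\<Sum>l<k. c l *\<^sub>R w l) = 0" "l < k" for c l
    proof -
      have "(\<Sum>l<m. (if l < k then c l else 0) *\<^sub>R w l) = (\<Sum>l<k. c l *\<^sub>R w l)"
        using \<open>k \<le> m\<close> by (intro sum.mono_neutral_cong_right) auto
      then show ?thesis using indep[of "\<lambda>l. if l < k then c l else 0" l] that \<open>k \<le> m\<close> by simp
    qed
    then obtain I :: "'n set" where I: "card I = k" "M I \<noteq> 0"
      unfolding M_def by (rule exists_nonzero_minor)
    then have "(\<Sum>I | I \<subseteq> (UNIV :: 'n set) \<and> card I = k. (M I / ?detC)\<^sup>2) > 0"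
      using detC by (intro sum_pos2[of _ I]) auto
    then show ?thesis by simp
  qed
  ultimately show thesis using that unfolding E_def by blast
qed

text \<open>The coefficients of \<open>\<Prod>l<m. [:- \<mu> l, 1:]\<close>, applied to consecutive derivatives starting from the
  first, annihilate all \<open>m\<close> modes, so the first \<open>m + 1\<close> derivatives are linearly dependent.\<close>

lemma deriv_volume_eq_0:
  fixes r :: "real \<Rightarrow> real^'n" and m :: nat
  assumes r: "\<And>t. 0 \<le> t \<Longrightarrow> r t = b + (\<Sum>l<m. exp (\<mu> l * t) *\<^sub>R w l)"
    and "m < k" and "0 \<le> t"
  shows "deriv_volume k r t = 0"
proof -
  define N where "N = (\<Prod>l<m. [:- \<mu> l, 1:])"
  have deg: "degree N = m" by (simp add: N_def degree_prod_linear)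
  have "N \<noteq> 0" by (simp add: N_def)
  then have "coeff N m \<noteq> 0" using deg by (metis leading_coeff_0_iff)
  have root: "(\<Sum>q<k. coeff N q * \<mu> l ^ q) = 0" if "l < m" for l
  proof -
    have "poly N (\<mu> l) = 0" using that by (auto simp: N_def poly_prod)
    then show ?thesis using poly_eq_sum_lessThan[of N k "\<mu> l"] deg \<open>m < k\<close> by simp
  qed
  have "Determinant.det (Matrix.mat k k (\<lambda>(p, q). curve_deriv (Suc q) r t $ from_nat_into I p)) = 0"
    for I :: "'n set"
  proof (rule det_mat_eq_0_if_kernel[where c = "coeff N"])
    fix p assume "p < k"
    have "(\<Sum>q<k. curve_deriv (Suc q) r t $ from_nat_into I p * coeff N q)
      = (\<Sum>q<k. \<Sum>l<m. \<mu> l ^ Suc q * exp (\<mu> l * t) * w l $ from_nat_into I p * coeff N q)"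
      using curve_deriv_exp_sum[OF r \<open>0 \<le> t\<close>] by (simp add: sum_distrib_right)
    also have "\<dots> = (\<Sum>l<m. \<Sum>q<k. \<mu> l ^ Suc q * exp (\<mu> l * t) * w l $ from_nat_into I p * coeff N q)"
      by (rule sum.swap)
    also have "\<dots> = (\<Sum>l<m. \<mu> l * exp (\<mu> l * t) * w l $ from_nat_into I p * (\<Sum>q<k. coeff N q * \<mu> l ^ q))"
      by (simp add: sum_distrib_left mult_ac)
    also have "\<dots> = 0" using root by simp
    finally show "(\<Sum>q<k. (case (p, q) of (p, q) \<Rightarrow> curve_deriv (Suc q) r t $ from_nat_into I p) * coeff N q) = 0"
      by simp
  qed (use \<open>m < k\<close> \<open>coeff N m \<noteq> 0\<close> in auto)
  then show ?thesis by (simp add: deriv_volume_def)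
qed

section \<open>Decay of the curvature\<close>

text \<open>With \<open>S k\<close> the sum of the \<open>k\<close> largest exponents, the growth rate of the curvature is
  \<open>S (i - 1) + S (i + 1) - S 1 - 2 * S i = \<mu> i - \<mu> (i - 1) - \<mu> 0 < 0\<close>. When there are at most \<open>i\<close>
  modes, the volume of order \<open>i + 1\<close> vanishes and so does the curvature.\<close>

lemma curvature_exp_sum_tendsto_0:
  fixes r :: "real \<Rightarrow> real^'n" and m :: nat
  assumes r: "\<And>t. 0 \<le> t \<Longrightarrow> r t = b + (\<Sum>l<m. exp (\<mu> l * t) *\<^sub>R w l)"
    and decreasing: "\<And>j l. j < l \<Longrightarrow> l < m \<Longrightarrow> \<mu> l < \<mu> j"
    and nz: "\<And>l. l < m \<Longrightarrow> \<mu> l \<noteq> 0"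
    and indep: "\<And>c l. (\<Sum>l<m. c l *\<^sub>R w l) = 0 \<Longrightarrow> l < m \<Longrightarrow> c l = 0"
    and pos: "\<mu> 0 > 0" and "i \<ge> 1"
  shows "(curvature i r \<longlongrightarrow> 0) at_top"
proof (cases "i < m")
  case False
  have "curvature i r t = 0" if "0 \<le> t" for t
    using deriv_volume_eq_0[OF r _ that, of "i + 1"] False by (simp add: curvature_def)
  then show ?thesis
    by (intro tendsto_eventually) (auto simp: eventually_at_top_linorder intro!: exI[of _ 0])
next
  case True
  obtain j where j: "i = Suc j" using \<open>i \<ge> 1\<close> by (cases i) auto
  define S where "S k = (\<Sum>l<k. \<mu> l)" for k
  define v where "v k t = deriv_volume k r t * exp (- S k * t)" for k t
  have "\<forall>k\<le>m. \<exists>L>0. (v k \<longlongrightarrow> L) at_top"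
    unfolding v_def S_def
    by (intro allI impI, rule deriv_volume_asymptotics[where r = r and b = b and \<mu> = \<mu> and w = w and m = m])
       (use r decreasing nz indep in blast)+
  then obtain L where Lpos: "\<And>k. k \<le> m \<Longrightarrow> L k > 0" and L: "\<And>k. k \<le> m \<Longrightarrow> (v k \<longlongrightarrow> L k) at_top"
    by metis
  have V: "deriv_volume k r t = v k t * exp (S k * t)" for k t
    by (simp add: v_def exp_minus)
  have S: "S 1 = \<mu> 0" "S (Suc j) = S j + \<mu> j" "S (Suc (Suc j)) = S j + \<mu> j + \<mu> (Suc j)"
    by (simp_all add: S_def)
  have curv: "curvature i r t
      = v j t * v (Suc (Suc j)) t / (v 1 t * (v (Suc j) t)\<^sup>2) * exp ((\<mu> (Suc j) - \<mu> j - \<mu> 0) * t)" for t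
  proof -
    have "exp (S j * t) * exp (S (Suc (Suc j)) * t) / (exp (S 1 * t) * (exp (S (Suc j) * t))\<^sup>2)
        = exp ((\<mu> (Suc j) - \<mu> j - \<mu> 0) * t)"
      unfolding S by (simp add: exp_add[symmetric] exp_diff[symmetric] exp_double[symmetric] algebra_simps)
    moreover have "curvature i r t = v j t * v (Suc (Suc j)) t / (v 1 t * (v (Suc j) t)\<^sup>2) *
      (exp (S j * t) * exp (S (Suc (Suc j)) * t) / (exp (S 1 * t) * (exp (S (Suc j) * t))\<^sup>2))"
      unfolding curvature_def j V by (simp add: power_mult_distrib mult_ac)
    ultimately show ?thesis by simp
  qed
  have "\<mu> (Suc j) - \<mu> j - \<mu> 0 < 0" using decreasing[of j "Suc j"] True pos j by simp
  note lim = exp_neg_tendsto_0[OF this]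
  have "((\<lambda>t. v j t * v (Suc (Suc j)) t / (v 1 t * (v (Suc j) t)\<^sup>2) * exp ((\<mu> (Suc j) - \<mu> j - \<mu> 0) * t))
    \<longlongrightarrow> L j * L (Suc (Suc j)) / (L 1 * (L (Suc j))\<^sup>2) * 0) at_top"
    by (intro tendsto_intros L lim) (use True j Lpos[of 1] Lpos[of "Suc j"] in auto)
  then show ?thesis unfolding curv[abs_def] by simp
qed

section \<open>Diagonalizable linear systems\<close>

text \<open>\<open>P\<close> passes to coordinates in an eigenbasis of \<open>A\<close>, \<open>Q\<close> is its inverse, and \<open>d\<close> lists the
  eigenvalues with multiplicity.\<close>

locale diagonalized_system =
  fixes A P Q :: "real^'n^'n" and d :: "'n \<Rightarrow> real"
  assumes PQ: "\<And>y. P *v (Q *v y) = y" and QP: "\<And>y. Q *v (P *v y) = y"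
    and PA: "\<And>y. P *v (A *v y) = (\<chi> j. d j * (P *v y) $ j)"
begin

text \<open>Grouping the eigencoordinates of \<open>x\<close> by eigenvalue gives the modes. Their supports in eigencoordinates
  are disjoint, and nonempty because no coordinate of \<open>x\<close> vanishes; this is what makes the modes
  independent.\<close>

lemma generic_solution_curvature_tendsto_0:
  assumes pos: "\<exists>j. d j > 0" and generic: "\<And>j. (P *v x) $ j \<noteq> 0" and "i \<ge> 1"
  obtains r where "lti_solution A r" "r 0 = x" "(curvature i r \<longlongrightarrow> 0) at_top"
proof -
  define xs where "xs = rev (sorted_list_of_set (range d - {0}))"
  define m where "m = length xs"
  define \<mu> where "\<mu> = (!) xs"
  define w where "w a = Q *v (\<chi> j. if d j = a then (P *v x) $ j else 0)" for a
  define r where "r t = w 0 + (\<Sum>l<m. exp (\<mu> l * t) *\<^sub>R w (\<mu> l))" for t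
  have set: "set xs = range d - {0}" by (simp add: xs_def)
  have "sorted_wrt (>) xs"
    using strict_sorted_list_of_set[of "range d - {0}"] by (simp add: xs_def sorted_wrt_rev)
  then have decreasing: "\<mu> l < \<mu> j" if "j < l" "l < m" for j l
    using that by (simp add: \<mu>_def m_def sorted_wrt_iff_nth_less)
  have nz: "\<mu> l \<noteq> 0" if "l < m" for l
    using that set nth_mem[of l xs] unfolding \<mu>_def m_def by auto
  have mu_index: "\<exists>l<m. d j = \<mu> l" if "d j \<noteq> 0" for j
    using that set by (metis Diff_iff \<mu>_def in_set_conv_nth m_def rangeI singletonD)
  have mu_inj: "\<mu> a = \<mu> b \<longleftrightarrow> a = b" if "a < m" "b < m" for a b
    using decreasing[of a b] decreasing[of b a] that by (cases a b rule: linorder_cases) auto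
  have Pw: "(P *v w a) $ j = (if d j = a then (P *v x) $ j else 0)" for a j
    by (simp add: w_def PQ)
  have P_inj: "y = z" if "\<And>j. (P *v y) $ j = (P *v z) $ j" for y z
    using that by (metis QP vec_eq_iff)
  have Psum: "(P *v (\<Sum>l<m. c l *\<^sub>R w (\<mu> l))) $ j = (\<Sum>l<m. c l * (P *v w (\<mu> l)) $ j)" for c j
    by (simp add: linear_sum[OF matrix_vector_mul_linear] matrix_vector_mult_scaleR)
  have Psum_eq: "(P *v (\<Sum>l<m. c l *\<^sub>R w (\<mu> l))) $ j = c l * (P *v x) $ j"
    if "l < m" "d j = \<mu> l" for c j l
  proof -
    have "(\<Sum>l<m. c l * (P *v w (\<mu> l)) $ j) = (\<Sum>a<m. if a = l then c a * (P *v x) $ j else 0)"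
      using that mu_inj by (intro sum.cong) (auto simp: Pw)
    then show ?thesis using that by (simp add: Psum)
  qed
  have eigen: "A *v w a = a *\<^sub>R w a" for a
    by (rule P_inj) (simp add: PA Pw matrix_vector_mult_scaleR)
  show thesis
  proof (rule that)
    show "lti_solution A r"
      unfolding lti_solution_def
    proof (intro allI impI)
      fix t :: real
      have "(r has_vector_derivative (\<Sum>l<m. (\<mu> l * exp (\<mu> l * t)) *\<^sub>R w (\<mu> l))) (at t within {0..})"
        unfolding r_def by (auto intro!: derivative_eq_intros simp: mult_ac)
      moreover have "A *v r t = (\<Sum>l<m. (\<mu> l * exp (\<mu> l * t)) *\<^sub>R w (\<mu> l))"
        by (simp add: r_def matrix_vector_right_distrib linear_sum[OF matrix_vector_mul_linear]
            matrix_vector_mult_scaleR eigen mult_ac)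
      ultimately show "(r has_vector_derivative A *v r t) (at t within {0..})" by simp
    qed
    show "r 0 = x"
    proof (rule P_inj)
      fix j
      show "(P *v r 0) $ j = (P *v x) $ j"
      proof (cases "d j = 0")
        case True
        then show ?thesis using nz Psum[of "\<lambda>_. 1" j]
          by (auto simp: r_def matrix_vector_right_distrib Pw)
      next
        case False
        then obtain l where "l < m" "d j = \<mu> l" using mu_index by blast
        then show ?thesis using False Psum_eq[of l j "\<lambda>_. 1"]
          by (simp add: r_def matrix_vector_right_distrib Pw)
      qed
    qed
    show "(curvature i r \<longlongrightarrow> 0) at_top"
    proof (rule curvature_exp_sum_tendsto_0[OF r_def decreasing nz _ _ \<open>i \<ge> 1\<close>])
      fix c l assume c: "(\<Sum>l<m. c l *\<^sub>R w (\<mu> l)) = 0" and l: "l < m"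
      then obtain j where "d j = \<mu> l"
        using set nth_mem[of l xs] unfolding \<mu>_def m_def by auto
      from Psum_eq[OF l this, of c] generic[of j] show "c l = 0" by (simp add: c)
    next
      obtain j where "d j > 0" using pos by blast
      then obtain l where "l < m" "d j = \<mu> l" using mu_index[of j] by auto
      then show "\<mu> 0 > 0" using decreasing[of 0 l] \<open>d j > 0\<close> by (cases "l = 0") auto
    qed
  qed
qed

text \<open>Uniqueness of solutions, one eigencoordinate at a time: multiplied by \<open>exp (- d j * t)\<close> it has
  derivative \<open>0\<close>.\<close>

lemma solution_coordinate:
  assumes "lti_solution A r" and "0 \<le> t"
  shows "(P *v r t) $ j = exp (d j * t) * (P *v r 0) $ j"
proof -
  define h where "h t = exp (- d j * t) * (P *v r t) $ j" for t
  have "(h has_vector_derivative 0) (at t within {0..})" if "t \<in> {0..}" for t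
  proof -
    have "(r has_vector_derivative A *v r t) (at t within {0..})"
      using assms(1) that by (simp add: lti_solution_def)
    then have "((\<lambda>t. (P *v r t) $ j) has_vector_derivative (P *v (A *v r t)) $ j) (at t within {0..})"
      by (intro bounded_linear.has_vector_derivative[OF bounded_linear_vec_nth]
          bounded_linear.has_vector_derivative[OF matrix_vector_mul_bounded_linear])
    then have "((\<lambda>t. (P *v r t) $ j) has_real_derivative d j * (P *v r t) $ j) (at t within {0..})"
      by (simp add: PA has_real_derivative_iff_has_vector_derivative)
    then have "(h has_real_derivative 0) (at t within {0..})"
      unfolding h_def by (auto intro!: derivative_eq_intros)
    then show ?thesis by (simp add: has_real_derivative_iff_has_vector_derivative)
  qed
  then obtain c where "\<And>t. t \<in> {0..} \<Longrightarrow> h t = c"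
    using has_vector_derivative_zero_constant[of "{0..}" h] by auto
  then have "h t = h 0" using \<open>0 \<le> t\<close> by simp
  then show ?thesis by (simp add: h_def exp_minus field_simps)
qed

lemma stable_if_nonpos:
  assumes "\<And>j. d j \<le> 0"
  shows "lti_stable A"
proof -
  obtain K where "K > 0" and K: "\<And>y. norm (Q *v y) \<le> norm y * K"
    using bounded_linear.pos_bounded[OF matrix_vector_mul_bounded_linear[of Q]] by blast
  obtain K' where "K' > 0" and K': "\<And>y. norm (P *v y) \<le> norm y * K'"
    using bounded_linear.pos_bounded[OF matrix_vector_mul_bounded_linear[of P]] by blast
  have bound: "norm (r t) \<le> norm (r 0) * (K' * K)" if r: "lti_solution A r" and "0 \<le> t" for r t
  proof -
    have "norm (P *v r t) \<le> norm (P *v r 0)"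
    proof (rule norm_le_componentwise_cart)
      fix j
      have "exp (d j * t) \<le> 1" using assms \<open>0 \<le> t\<close> by (simp add: mult_nonpos_nonneg)
      then show "norm ((P *v r t) $ j) \<le> norm ((P *v r 0) $ j)"
        by (simp add: solution_coordinate[OF that] abs_mult mult_left_le_one_le)
    qed
    then have "norm (Q *v (P *v r t)) \<le> norm (r 0) * K' * K"
      using K[of "P *v r t"] K'[of "r 0"] \<open>K > 0\<close>
      by (meson mult_le_cancel_right_pos order_trans)
    then show ?thesis by (simp add: QP mult_ac)
  qed
  show ?thesis
    unfolding lti_stable_def
  proof (intro allI impI)
    fix \<epsilon> :: real assume "\<epsilon> > 0"
    show "\<exists>\<delta>>0. \<forall>r. lti_solution A r \<longrightarrow> norm (r 0) < \<delta> \<longrightarrow> (\<forall>t\<ge>0. norm (r t) < \<epsilon>)"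
    proof (intro exI[of _ "\<epsilon> / (K' * K)"] conjI allI impI)
      show "\<epsilon> / (K' * K) > 0" using \<open>\<epsilon> > 0\<close> \<open>K > 0\<close> \<open>K' > 0\<close> by simp
      fix r and t :: real
      assume "lti_solution A r" "norm (r 0) < \<epsilon> / (K' * K)" "0 \<le> t"
      then show "norm (r t) < \<epsilon>"
        using bound[of r t] \<open>K > 0\<close> \<open>K' > 0\<close> by (simp add: pos_less_divide_eq)
    qed
  qed
qed

lemma asymptotically_stable_if_neg:
  assumes "\<And>j. d j < 0"
  shows "lti_asymptotically_stable A"
proof -
  have "(r \<longlongrightarrow> 0) at_top" if r: "lti_solution A r" for r
  proof -
    have "((\<lambda>t. P *v r t) \<longlongrightarrow> 0) at_top"
    proof (rule vec_tendstoI)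
      fix j
      have "((\<lambda>t. exp (d j * t) * (P *v r 0) $ j) \<longlongrightarrow> 0) at_top"
        using tendsto_mult_right[OF exp_neg_tendsto_0[OF assms]] by auto
      then show "((\<lambda>t. (P *v r t) $ j) \<longlongrightarrow> 0 $ j) at_top"
        unfolding zero_index
        by (rule Lim_transform_eventually)
          (use solution_coordinate[OF r, symmetric] in
            \<open>force simp: eventually_at_top_linorder intro: exI[of _ 0]\<close>)
    qed
    from bounded_linear.tendsto[OF matrix_vector_mul_bounded_linear[of Q] this]
    show ?thesis by (simp add: QP)
  qed
  moreover have "lti_stable A" using assms by (intro stable_if_nonpos) (simp add: less_imp_le)
  ultimately show ?thesis
    unfolding lti_asymptotically_stable_def by (auto intro!: exI[of _ 1])
qed

text \<open>Each row of \<open>P\<close> is nonzero because \<open>P\<close> is invertible, so the set is a finite union of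
  hyperplanes.\<close>

lemma negligible_nongeneric: "negligible {x. \<exists>j. (P *v x) $ j = 0}"
proof -
  have "negligible {x. (P *v x) $ j = 0}" for j
  proof -
    have "P $ j \<noteq> 0"
      using PQ[of "axis j 1"] matrix_vector_mul_component[of P "Q *v axis j 1" j]
      by (metis axis_nth inner_zero_left one_neq_zero)
    then show ?thesis using negligible_hyperplane[of "P $ j" 0]
      by (simp add: matrix_vector_mul_component)
  qed
  then have "negligible (\<Union>j. {x. (P *v x) $ j = 0})"
    by (intro negligible_Union) auto
  moreover have "{x. \<exists>j. (P *v x) $ j = 0} = (\<Union>j. {x. (P *v x) $ j = 0})" by auto
  ultimately show ?thesis by simp
qed

lemma nonpos_if_curvature_not_tendsto_0:
  assumes E: "E \<in> sets lebesgue" "emeasure lebesgue E > 0"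
    and curv: "\<And>r. lti_solution A r \<Longrightarrow> r 0 \<in> E \<Longrightarrow> \<not> (curvature i r \<longlongrightarrow> 0) at_top"
    and "i \<ge> 1"
  shows "d j \<le> 0"
proof (rule ccontr)
  assume "\<not> d j \<le> 0"
  then have pos: "\<exists>j. d j > 0" by (auto simp: not_le)
  have "\<not> E \<subseteq> {x. \<exists>j. (P *v x) $ j = 0}"
  proof
    assume "E \<subseteq> {x. \<exists>j. (P *v x) $ j = 0}"
    then have "negligible E" using negligible_nongeneric negligible_subset by blast
    then have "emeasure lebesgue E = 0"
      by (simp add: negligible_iff_null_sets null_setsD1)
    with E(2) show False by simp
  qed
  then obtain x where "x \<in> E" "\<And>j. (P *v x) $ j \<noteq> 0" by blast
  then show False
    using generic_solution_curvature_tendsto_0[OF pos _ \<open>i \<ge> 1\<close>, of x] curv by metis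
qed

lemma nonzero_if_invertible:
  assumes "invertible A"
  shows "d j \<noteq> 0"
proof
  assume "d j = 0"
  obtain B where "B ** A = mat 1" using assms by (auto simp: invertible_def)
  define y where "y = Q *v axis j 1"
  have "P *v (A *v y) = 0"
    using \<open>d j = 0\<close> by (auto simp: PA y_def PQ vec_eq_iff axis_def)
  then have "A *v y = 0" using QP[of "A *v y"] by simp
  then have "y = 0"
    using \<open>B ** A = mat 1\<close> by (metis matrix_vector_mul_assoc matrix_vector_mul_lid matrix_vector_mult_0_right)
  then have "axis j 1 = (0 :: real^'n)" using PQ[of "axis j 1"] by (simp add: y_def)
  then show False by (simp add: axis_eq_0_iff)
qed

end

lemma diagonalized_systemI:
  fixes A D :: "real^'n^'n"
  assumes "is_diagonal D" and "similar_matrix A D"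
  obtains P Q where "diagonalized_system A P Q (\<lambda>j. D $ j $ j)"
proof -
  obtain P where P: "invertible P" and A: "A = matrix_inv P ** D ** P"
    using assms(2) unfolding similar_matrix_def by blast
  have "P ** matrix_inv P = mat 1 \<and> matrix_inv P ** P = mat 1"
    using P unfolding invertible_def matrix_inv_def by (rule someI_ex)
  then have inv: "P *v (matrix_inv P *v y) = y" "matrix_inv P *v (P *v y) = y" for y
    by (simp_all add: matrix_vector_mul_assoc)
  have D: "D *v y = (\<chi> j. D $ j $ j * y $ j)" for y
  proof (subst vec_eq_iff, rule allI)
    fix j
    have "(D *v y) $ j = (\<Sum>k\<in>UNIV. if k = j then D $ j $ j * y $ j else 0)"
      unfolding matrix_vector_mult_def vec_lambda_beta
      using assms(1) by (intro sum.cong) (auto simp: is_diagonal_def)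
    then show "(D *v y) $ j = (\<chi> j. D $ j $ j * y $ j) $ j" by simp
  qed
  have "diagonalized_system A P (matrix_inv P) (\<lambda>j. D $ j $ j)"
  proof
    show "P *v (A *v y) = (\<chi> j. D $ j $ j * (P *v y) $ j)" for y
      unfolding A by (simp add: matrix_vector_mul_assoc[symmetric] inv D)
  qed (fact inv)+
  then show thesis by (rule that)
qed

section \<open>Curvature and stability\<close>

theorem theorem1p1:
  fixes A :: "real^'n^'n" and i :: nat
  assumes "\<exists>D. is_diagonal D \<and> similar_matrix A D"
    and "i \<ge> 1"
  shows "((\<exists>E \<in> sets (lebesgue :: (real^'n) measure). emeasure lebesgue E > 0 \<and>
            (\<forall>r. lti_solution A r \<and> r 0 \<in> E \<longrightarrow> \<not> (curvature i r \<longlongrightarrow> 0) at_top))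
          \<longrightarrow> lti_stable A)
       \<and> (invertible A \<and>
          (\<exists>E \<in> sets (lebesgue :: (real^'n) measure). emeasure lebesgue E > 0 \<and>
            (\<forall>r. lti_solution A r \<and> r 0 \<in> E \<longrightarrow> \<not> (curvature i r \<longlongrightarrow> 0) at_top))
          \<longrightarrow> lti_asymptotically_stable A)"
proof -
  obtain D where "is_diagonal D" "similar_matrix A D" using assms(1) by blast
  then obtain P Q where "diagonalized_system A P Q (\<lambda>j. D $ j $ j)"
    by (rule diagonalized_systemI)
  then interpret diagonalized_system A P Q "\<lambda>j. D $ j $ j" .
  have nonpos: "D $ j $ j \<le> 0"
    if "\<exists>E \<in> sets lebesgue. emeasure lebesgue E > 0 \<and>
            (\<forall>r. lti_solution A r \<and> r 0 \<in> E \<longrightarrow> \<not> (curvature i r \<longlongrightarrow> 0) at_top)" for j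
    using that nonpos_if_curvature_not_tendsto_0[OF _ _ _ \<open>i \<ge> 1\<close>] by blast
  show ?thesis
  proof (intro conjI impI; (elim conjE)?)
    assume "\<exists>E \<in> sets lebesgue. emeasure lebesgue E > 0 \<and>
            (\<forall>r. lti_solution A r \<and> r 0 \<in> E \<longrightarrow> \<not> (curvature i r \<longlongrightarrow> 0) at_top)"
    note nonpos = nonpos[OF this]
    show "lti_stable A" using nonpos by (rule stable_if_nonpos)
    assume "invertible A"
    show "lti_asymptotically_stable A"
      using nonpos nonzero_if_invertible[OF \<open>invertible A\<close>]
      by (intro asymptotically_stable_if_neg) (simp add: less_le)
  qed
qed

end
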